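(* Let $\xi>0$, let $n=(\frac12+\xi)k\sqrt{k}\ln k$, and let $G$ be chosen according to $\Sigma(K_{n,n};k)$. Then there is a constant $k_0=k_0(\xi)$ such that for all $k>k_0$, \[\Pr[R(G)\ne k]\le\frac{2}{k^{\xi}}.\]
   Context: Random word model $\Sigma(K_{n,n};k)$: $K_{n,n}$ has sides $A=\{a_1,\ldots,a_n\}$, $B=\{b_1,\ldots,b_n\}$; each vertex independently receives a uniform symbol from $[k]$, and one keeps exactly the edges $a_ib_j$ whose endpoints have the same symbol (the symbol associated to the edge). Edges $a_ib_j$, $a_{i'}b_{j'}$ are noncrossing if ($i<i'$ and $j<j'$) or ($i'<i$ and $j'<j$); a matching is noncrossing if its edges are pairwise noncrossing and repetition-free if the symbols of its edges are pairwise distinct; $R(G)\le k$ is the maximum size of a repetition-free noncrossing matching of $G$. Integrality issues are ignored, as in the paper. *)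

theory Defs
  imports "HOL-Probability.Probability"
begin

text \<open>The vertices of \<open>K\<^sub>n\<^sub>,\<^sub>n\<close> are \<open>VA i\<close> and \<open>VB j\<close> with \<open>1 \<le> i, j \<le> n\<close>.\<close>

datatype vertex = VA nat | VB nat

definition vertices_K :: "nat \<Rightarrow> vertex set" where
  "vertices_K n = VA ` {1..n} \<union> VB ` {1..n}"

text \<open>The pair \<open>(i, j)\<close> stands for the edge joining \<open>VA i\<close> and \<open>VB j\<close>.\<close>

type_synonym edge = "nat \<times> nat"

definition edges_K :: "nat \<Rightarrow> edge set" where
  "edges_K n = {1..n} \<times> {1..n}"

text \<open>
  A graph whose edges carry symbols is a partial map: its domain is the edge set, and each edge
  is mapped to its symbol.
\<close>

type_synonym symbol_graph = "edge \<rightharpoonup> nat"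

definition kept_graph :: "nat \<Rightarrow> (vertex \<Rightarrow> nat) \<Rightarrow> symbol_graph" where
  "kept_graph n w =
     (\<lambda>(i, j). if (i, j) \<in> edges_K n \<and> w (VA i) = w (VB j) then Some (w (VA i)) else None)"

text \<open>
  The random word model \<open>\<Sigma>(K\<^sub>n\<^sub>,\<^sub>n; k)\<close>. The default value 0 given to \<^const>\<open>Pi_pmf\<close> is only
  taken outside the vertex set, which \<^const>\<open>kept_graph\<close> never inspects.
\<close>

definition random_word_graph :: "nat \<Rightarrow> nat \<Rightarrow> symbol_graph pmf" where
  "random_word_graph n k =
     map_pmf (kept_graph n) (Pi_pmf (vertices_K n) 0 (\<lambda>_. pmf_of_set {1..k}))"

definition is_matching :: "edge set \<Rightarrow> bool" where
  "is_matching M \<longleftrightarrow> (\<forall>e\<in>M. \<forall>f\<in>M. e \<noteq> f \<longrightarrow> fst e \<noteq> fst f \<and> snd e \<noteq> snd f)"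

definition noncrossing_edges :: "edge \<Rightarrow> edge \<Rightarrow> bool" where
  "noncrossing_edges e f \<longleftrightarrow>
     (fst e < fst f \<and> snd e < snd f) \<or> (fst f < fst e \<and> snd f < snd e)"

definition noncrossing :: "edge set \<Rightarrow> bool" where
  "noncrossing M \<longleftrightarrow> (\<forall>e\<in>M. \<forall>f\<in>M. e \<noteq> f \<longrightarrow> noncrossing_edges e f)"

definition repetition_free :: "symbol_graph \<Rightarrow> edge set \<Rightarrow> bool" where
  "repetition_free G M \<longleftrightarrow> (\<forall>e\<in>M. \<forall>f\<in>M. e \<noteq> f \<longrightarrow> the (G e) \<noteq> the (G f))"

text \<open>The maximum is meaningful for graphs with finitely many edges.\<close>

definition R :: "symbol_graph \<Rightarrow> nat" where
  "R G = Max (card ` {M. M \<subseteq> dom G \<and> is_matching M \<and> noncrossing M \<and> repetition_free G M})"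

end

theory Submission imports Defs "HOL-Library.Sublist" "HOL-Real_Asymp.Real_Asymp"
begin

text \<open>
  \<open>R G = k\<close> holds as soon as the words on the two sides have a common subsequence that is a
  permutation of \<open>{1..k}\<close>. Such a subsequence is built greedily: cut both words into \<open>k\<close> blocks, and
  in each pair of blocks pick a common symbol that has not been used yet. While \<open>j\<close> symbols are
  missing, blocks of length \<open>t\<close> provide none of them with probability at most \<open>(1 - p\<^sup>2)\<^sup>j\<close> where
  \<open>p = 1 - (1 - 1/k)\<^sup>t\<close>, just as if the symbols occurred independently of each other. Taking \<open>t\<close> of order
  \<open>k sqrt (ln k / j)\<close>, and of order \<open>k ln k\<close> for the last \<open>O(ln k)\<close> symbols, bounds each of the \<open>k\<close> failure
  probabilities by \<open>k powr (-1 - \<xi>)\<close>, while the total length is only \<open>O(k sqrt k sqrt (ln k))\<close>.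
\<close>

section \<open>Probabilities in two-stage experiments\<close>

lemma measure_pmf_bind_le:
  assumes "\<And>x. x \<in> set_pmf p \<Longrightarrow> measure_pmf.prob (f x) E \<le> g x"
      and "integrable (measure_pmf p) g"
  shows "measure_pmf.prob (bind_pmf p f) E \<le> measure_pmf.expectation p g"
proof -
  have int: "integrable (measure_pmf p) (\<lambda>x. measure_pmf.prob (f x) E)"
    by (rule measure_pmf.integrable_const_bound[where B = 1]) auto
  have "ennreal (measure_pmf.prob (bind_pmf p f) E) = (\<integral>\<^sup>+x. emeasure (f x) E \<partial>p)"
    by (simp flip: measure_pmf.emeasure_eq_measure)
  also have "\<dots> = ennreal (measure_pmf.expectation p (\<lambda>x. measure_pmf.prob (f x) E))"
    using int by (simp add: measure_pmf.emeasure_eq_measure nn_integral_eq_integral)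
  finally have "measure_pmf.prob (bind_pmf p f) E = measure_pmf.expectation p (\<lambda>x. measure_pmf.prob (f x) E)"
    by (simp add: integral_nonneg_AE)
  also have "\<dots> \<le> measure_pmf.expectation p g"
    using assms int by (intro integral_mono_AE) (auto simp: AE_measure_pmf_iff)
  finally show ?thesis .
qed

text \<open>Union bound over two stages: either the first lands in the bad set \<open>A\<close>, or
  the second fails with probability at most \<open>\<delta>\<close>. One greedy step has this
  form.\<close>

lemma measure_pmf_bind_le_add:
  assumes "\<And>x. x \<in> set_pmf p \<Longrightarrow> x \<notin> A \<Longrightarrow> measure_pmf.prob (f x) E \<le> \<delta>" and "0 \<le> \<delta>"
  shows "measure_pmf.prob (bind_pmf p f) E \<le> measure_pmf.prob p A + \<delta>"
proof -
  have int: "integrable (measure_pmf p) (indicator A :: _ \<Rightarrow> real)"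
    by (rule measure_pmf.integrable_const_bound[where B = 1]) auto
  have "measure_pmf.prob (bind_pmf p f) E \<le> measure_pmf.expectation p (\<lambda>x. indicator A x + \<delta>)"
  proof (rule measure_pmf_bind_le)
    fix x assume "x \<in> set_pmf p"
    with assms show "measure_pmf.prob (f x) E \<le> indicator A x + \<delta>"
      by (cases "x \<in> A") (auto intro: add_increasing2)
  qed (use int in auto)
  also have "\<dots> = measure_pmf.prob p A + \<delta>"
    using int by (simp add: Bochner_Integration.integral_add)
  finally show ?thesis .
qed

text \<open>Links vertex labels to words. Since \<open>x\<close> does not occur in
  \<open>xs\<close>, the update at \<open>x\<close> leaves the entries read along \<open>xs\<close>
  unchanged.\<close>

lemma map_pmf_Pi_pmf_list:
  assumes "distinct xs"
  shows "map_pmf (\<lambda>f. map f xs) (Pi_pmf (set xs) d (\<lambda>_. p)) = replicate_pmf (length xs) p"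
  using assms
proof (induction xs)
  case (Cons x xs)
  have *: "map (f(x := y)) xs = map f xs" for f y
    using Cons.prems by (auto simp: map_eq_conv)
  have "map_pmf (\<lambda>f. map f (x # xs)) (Pi_pmf (set (x # xs)) d (\<lambda>_. p)) =
      p \<bind> (\<lambda>y. map_pmf (\<lambda>f. y # map f xs) (Pi_pmf (set xs) d (\<lambda>_. p)))"
    using Cons.prems
    by (simp add: Pi_pmf_insert' map_bind_pmf * map_pmf_def[symmetric] del: fun_upd_apply)
       (simp add: map_pmf_def bind_assoc_pmf bind_return_pmf *)
  also have "\<dots> = p \<bind> (\<lambda>y. map_pmf (Cons y) (map_pmf (\<lambda>f. map f xs) (Pi_pmf (set xs) d (\<lambda>_. p))))"
    by (simp add: pmf.map_comp o_def)
  finally show ?case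
    using Cons by (simp add: map_pmf_def)
qed simp

section \<open>Random words and the symbols they contain\<close>

definition word_pmf :: "nat \<Rightarrow> nat \<Rightarrow> nat list pmf" where
  "word_pmf k m = replicate_pmf m (pmf_of_set {1..k})"

lemma set_word_pmf: "k > 0 \<Longrightarrow> set_pmf (word_pmf k m) = {xs. set xs \<subseteq> {1..k} \<and> length xs = m}"
  by (auto simp: word_pmf_def set_replicate_pmf)

lemma finite_set_word_pmf: "k > 0 \<Longrightarrow> finite (set_pmf (word_pmf k m))"
  using finite_lists_length_eq[of "{1..k}" m] by (simp add: set_word_pmf)

lemma word_pmf_add:
  "word_pmf k (m + n) = word_pmf k m \<bind> (\<lambda>xs. map_pmf (\<lambda>ys. xs @ ys) (word_pmf k n))"
  by (simp add: word_pmf_def replicate_pmf_distrib map_pmf_def)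

lemma expectation_word_pmf_Suc:
  fixes h :: "nat list \<Rightarrow> real"
  assumes "k > 0"
  shows "measure_pmf.expectation (word_pmf k (Suc m)) h =
    (\<Sum>x\<in>{1..k}. measure_pmf.expectation (word_pmf k m) (\<lambda>xs. h (x # xs))) / k"
proof -
  have eq: "word_pmf k (Suc m) = pmf_of_set {1..k} \<bind> (\<lambda>x. map_pmf (Cons x) (word_pmf k m))"
    by (simp add: word_pmf_def map_pmf_def)
  show ?thesis
    unfolding eq using assms
    by (subst pmf_expectation_bind_pmf_of_set)
       (auto simp: finite_set_word_pmf sum_divide_distrib divide_inverse mult.commute simp flip: sum_distrib_left)
qed

text \<open>
  The right-hand side is the value the expectation would have if the events \<open>s \<in> set xs\<close>, for
  \<open>s \<in> S\<close>, were independent. Conditioning on the first letter reduces the induction step to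
  Bernoulli's inequality.
\<close>

lemma expectation_word_pmf_power:
  fixes q :: real
  assumes k: "k > 0" and S: "S \<subseteq> {1..k}" and q: "0 < q" "q \<le> 1"
  shows "measure_pmf.expectation (word_pmf k m) (\<lambda>xs. q ^ card (S \<inter> set xs)) \<le>
    (q + (1 - 1 / k) ^ m * (1 - q)) ^ card S"
  using S
proof (induction m arbitrary: S)
  case 0
  then show ?case by (simp add: word_pmf_def)
next
  case (Suc m)
  let ?E = "\<lambda>S. measure_pmf.expectation (word_pmf k m) (\<lambda>xs. q ^ card (S \<inter> set xs))"
  define y where "y = q + (1 - 1 / k) ^ m * (1 - q)"
  \<comment> \<open>Chosen so that \<open>y * (1 - z)\<close> is the base of the claimed power for
    \<open>Suc m\<close>.\<close>
  define z where "z = (1 - q / y) / k"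
  have "0 \<le> (1 - 1 / real k) ^ m" "(1 - 1 / real k) ^ m \<le> 1"
    using k by (auto intro!: power_le_one)
  then have y: "q \<le> y" "0 < y" using q by (auto simp: y_def intro: add_pos_nonneg)
  then have z: "0 \<le> z" "z \<le> 1" using q k by (auto simp: z_def divide_le_eq_1 zero_le_divide_iff intro: order_trans[of _ 1])
  have fin: "finite S" and cS: "card S \<le> k"
    using Suc.prems finite_subset[of S "{1..k}"] card_mono[of "{1..k}" S] by auto
  \<comment> \<open>A first letter \<open>x\<close> in \<open>S\<close> contributes one factor
    \<open>q\<close>; the remaining letters then matter only for \<open>S - {x}\<close>.\<close>
  have out: "?E (S - {x}) * q = measure_pmf.expectation (word_pmf k m) (\<lambda>xs. q ^ card (S \<inter> set (x # xs)))"
    if "x \<in> S" for x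
  proof -
    have *: "S \<inter> set (x # xs) = insert x ((S - {x}) \<inter> set xs)" for xs
      using that by auto
    have "card (S \<inter> set (x # xs)) = Suc (card ((S - {x}) \<inter> set xs))" for xs
      unfolding * using fin by (intro card_insert_disjoint) auto
    then show ?thesis by (simp add: mult.commute)
  qed
  have "measure_pmf.expectation (word_pmf k (Suc m)) (\<lambda>xs. q ^ card (S \<inter> set xs)) =
    (\<Sum>x\<in>{1..k}. measure_pmf.expectation (word_pmf k m) (\<lambda>xs. q ^ card (S \<inter> set (x # xs)))) / k"
    using k by (rule expectation_word_pmf_Suc)
  also have "(\<Sum>x\<in>{1..k}. measure_pmf.expectation (word_pmf k m) (\<lambda>xs. q ^ card (S \<inter> set (x # xs)))) =
      (\<Sum>x\<in>S. ?E (S - {x}) * q) + (\<Sum>x\<in>{1..k} - S. ?E S)"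
    using Suc.prems fin
    by (subst sum.subset_diff[of S]) (auto simp: out intro!: arg_cong2[where f = "(+)"] sum.cong)
  also have "\<dots> \<le> (\<Sum>x\<in>S. y ^ (card S - 1) * q) + (\<Sum>x\<in>{1..k} - S. y ^ card S)"
  proof (intro add_mono sum_mono mult_right_mono)
    fix x assume "x \<in> S"
    then show "?E (S - {x}) \<le> y ^ (card S - 1)"
      using Suc.IH[of "S - {x}"] Suc.prems fin by (auto simp: y_def)
  next
    show "?E S \<le> y ^ card S" using Suc.IH[of S] Suc.prems by (auto simp: y_def)
  qed (use q in auto)
  \<comment> \<open>The sums are \<open>card S * y ^ (card S - 1) * q\<close> and
    \<open>(k - card S) * y ^ card S\<close>; the case split keeps the exponent
    \<open>card S - 1\<close> from truncating.\<close>
  also have "\<dots> = real k * y ^ card S * (1 - card S * z)"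
  proof (cases "card S")
    case (Suc c)
    have "card ({1..k} - S) = k - card S" using Suc.prems fin
      by (subst card_Diff_subset) (use \<open>S \<subseteq> {1..k}\<close> in auto)
    then show ?thesis
      using Suc y k cS by (simp add: z_def field_simps of_nat_diff)
  qed (use fin in auto)
  also have "\<dots> / k = y ^ card S * (1 - card S * z)" using k by simp
  also have "\<dots> \<le> y ^ card S * (1 - z) ^ card S"
    using Bernoulli_inequality[of "-z" "card S"] y z by (intro mult_left_mono) auto
  also have "\<dots> = (y * (1 - z)) ^ card S" by (simp add: power_mult_distrib)
  also have "y * (1 - z) = q + (1 - 1 / k) ^ Suc m * (1 - q)"
    using y k by (simp add: z_def field_simps) (simp add: y_def field_simps)
  finally show ?case using k by (simp add: divide_right_mono)
qed

text \<open>One letter avoids \<open>T\<close> with probability \<open>1 - card T / k\<close>, at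
  most \<open>(1 - 1 / k) ^ card T\<close> by Bernoulli, and letters are independent. The shape
  \<open>q ^ card T\<close> is the one whose expectation is bounded above.\<close>

lemma prob_word_pmf_avoid:
  assumes k: "k > 0" and T: "T \<subseteq> {1..k}"
  shows "measure_pmf.prob (word_pmf k m) {ys. T \<inter> set ys = {}} \<le> ((1 - 1 / k) ^ m) ^ card T"
proof (induction m)
  case (Suc m)
  have fin: "finite T" and cT: "card T \<le> k"
    using T finite_subset[of T "{1..k}"] card_mono[of "{1..k}" T] by auto
  have eq: "word_pmf k (Suc m) = pmf_of_set {1..k} \<bind> (\<lambda>x. map_pmf (Cons x) (word_pmf k m))"
    by (simp add: word_pmf_def map_pmf_def)
  let ?B = "((1 - 1 / real k) ^ m) ^ card T"
  have B: "0 \<le> ?B" using k by (auto intro!: zero_le_power simp: field_simps)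
  have "measure_pmf.prob (word_pmf k (Suc m)) {ys. T \<inter> set ys = {}} \<le>
    measure_pmf.expectation (pmf_of_set {1..k}) (\<lambda>x. indicator (- T) x * ?B)"
    unfolding eq
  proof (rule measure_pmf_bind_le)
    fix x
    show "measure_pmf.prob (map_pmf (Cons x) (word_pmf k m)) {ys. T \<inter> set ys = {}} \<le> indicator (- T) x * ?B"
      using Suc.IH by (cases "x \<in> T") auto
  qed (use k in \<open>auto intro!: integrable_measure_pmf_finite\<close>)
  also have "\<dots> = measure_pmf.prob (pmf_of_set {1..k}) (- T) * ?B"
    by simp
  also have "measure_pmf.prob (pmf_of_set {1..k}) (- T) = 1 - card T / k"
  proof -
    have "{1..k} \<inter> - T = {1..k} - T" by auto
    then show ?thesis using k T fin cT
      by (simp add: measure_pmf_of_set card_Diff_subset of_nat_diff diff_divide_distrib)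
  qed
  also have "1 - card T / k \<le> (1 - 1 / k) ^ card T"
    using Bernoulli_inequality[of "-1 / real k" "card T"] k by (simp add: field_simps)
  finally show ?case using B by (simp add: mult_right_mono power_mult_distrib)
qed (simp add: word_pmf_def)

text \<open>Given \<open>xs\<close>, the second word has to avoid \<open>S \<inter> set xs\<close>,
  which costs \<open>?q ^ card (S \<inter> set xs)\<close>; this is then averaged over
  \<open>xs\<close>.\<close>

lemma prob_word_pair_disjoint:
  assumes k: "k > 1" and S: "S \<subseteq> {1..k}"
  shows "measure_pmf.prob (pair_pmf (word_pmf k m) (word_pmf k m)) {(xs, ys). S \<inter> set xs \<inter> set ys = {}} \<le>
    (1 - (1 - (1 - 1 / k) ^ m)\<^sup>2) ^ card S"
proof -
  let ?q = "(1 - 1 / real k) ^ m"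
  have q: "0 < ?q" "?q \<le> 1"
    using k by (auto intro!: power_le_one zero_less_power)
  have "measure_pmf.prob (pair_pmf (word_pmf k m) (word_pmf k m))
      {(xs, ys). S \<inter> set xs \<inter> set ys = {}} =
    measure_pmf.prob (word_pmf k m \<bind> (\<lambda>xs. map_pmf (\<lambda>ys. (xs, ys)) (word_pmf k m))) {(xs, ys). S \<inter> set xs \<inter> set ys = {}}"
    by (simp add: pair_pmf_def map_pmf_def)
  also have "\<dots> \<le> measure_pmf.expectation (word_pmf k m) (\<lambda>xs. ?q ^ card (S \<inter> set xs))"
  proof (rule measure_pmf_bind_le)
    fix xs
    show "measure_pmf.prob (map_pmf (\<lambda>ys. (xs, ys)) (word_pmf k m))
        {(xs, ys). S \<inter> set xs \<inter> set ys = {}} \<le> ?q ^ card (S \<inter> set xs)"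
      using prob_word_pmf_avoid[of k "S \<inter> set xs" m] k S by (auto simp: vimage_def)
  qed (use k in \<open>auto intro!: integrable_measure_pmf_finite finite_set_word_pmf\<close>)
  also have "\<dots> \<le> (?q + ?q * (1 - ?q)) ^ card S"
    using k S q by (intro expectation_word_pmf_power) auto
  also have "?q + ?q * (1 - ?q) = 1 - (1 - ?q)\<^sup>2"
    by (simp add: power2_eq_square algebra_simps)
  finally show ?thesis .
qed

section \<open>The greedy construction of a common permutation\<close>

text \<open>The witness is an ordering of \<open>S\<close>. The goal is \<open>S = {1..k}\<close>;
  smaller \<open>S\<close> are the sets of symbols still missing.\<close>

definition common_perm :: "nat set \<Rightarrow> nat list \<Rightarrow> nat list \<Rightarrow> bool" where
  "common_perm S xs ys \<longleftrightarrow> (\<exists>zs. subseq zs xs \<and> subseq zs ys \<and> distinct zs \<and> set zs = S)"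

lemma common_perm_append:
  assumes "s \<in> S" "s \<in> set xs" "s \<in> set ys" "common_perm (S - {s}) xs' ys'"
  shows "common_perm S (xs @ xs') (ys @ ys')"
proof -
  from assms obtain zs where zs: "subseq zs xs'" "subseq zs ys'" "distinct zs" "set zs = S - {s}"
    by (auto simp: common_perm_def)
  have "subseq [s] xs" "subseq [s] ys"
    using assms by (simp_all add: subseq_singleton_left)
  then have "subseq ([s] @ zs) (xs @ xs')" "subseq ([s] @ zs) (ys @ ys')"
    using zs by (blast intro: list_emb_append_mono)+
  then show ?thesis using zs assms unfolding common_perm_def
    by (intro exI[of _ "[s] @ zs"]) auto
qed

text \<open>The draws come in the order \<open>xs\<close>, \<open>xs'\<close>, \<open>ys\<close>,
  \<open>ys'\<close> on the left and \<open>xs\<close>, \<open>ys\<close>, \<open>xs'\<close>,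
  \<open>ys'\<close> on the right; the middle two are independent and commute.\<close>

lemma pair_word_pmf_add:
  "pair_pmf (word_pmf k (m + n)) (word_pmf k (m + n)) =
    pair_pmf (word_pmf k m) (word_pmf k m) \<bind> (\<lambda>(xs, ys).
      map_pmf (\<lambda>(xs', ys'). (xs @ xs', ys @ ys')) (pair_pmf (word_pmf k n) (word_pmf k n)))"
  by (simp add: word_pmf_add pair_pmf_def map_pmf_def bind_assoc_pmf bind_return_pmf)
     (intro bind_pmf_cong[OF refl], rule bind_commute_pmf)

text \<open>Union bound over the greedy steps: \<open>t j\<close> is the length of the blocks
  inspected while \<open>j\<close> symbols are missing. \<open>S\<close> is arbitrary because the
  missing set depends on earlier blocks; surplus letters in \<open>N\<close> do no harm.\<close>

lemma prob_no_common_perm: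
  fixes t :: "nat \<Rightarrow> nat" and \<epsilon> :: real
  assumes k: "k > 1" and \<epsilon>: "\<epsilon> \<ge> 0"
    and t: "\<And>j. 1 \<le> j \<Longrightarrow> j \<le> k \<Longrightarrow> (1 - (1 - (1 - 1 / k) ^ t j)\<^sup>2) ^ j \<le> \<epsilon>"
    and S: "S \<subseteq> {1..k}" and N: "(\<Sum>j=1..card S. t j) \<le> N"
  shows "measure_pmf.prob (pair_pmf (word_pmf k N) (word_pmf k N)) {(xs, ys). \<not> common_perm S xs ys} \<le> card S * \<epsilon>"
  using S N
proof (induction "card S" arbitrary: S N)
  case 0
  then have "S = {}" using finite_subset[of S "{1..k}"] by simp
  then show ?case by (simp add: common_perm_def)
next
  case (Suc j)
  have fin: "finite S" and cS: "card S \<le> k"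
    using Suc.prems finite_subset[of S "{1..k}"] card_mono[of "{1..k}" S] by auto
  define m where "m = t (Suc j)"
  define n where "n = N - m"
  have N: "N = m + n" and n: "(\<Sum>i=1..j. t i) \<le> n"
    using Suc.prems(2) by (auto simp: m_def n_def simp flip: Suc.hyps(2))
  let ?A = "{(xs, ys). S \<inter> set xs \<inter> set ys = {}}"
  have "measure_pmf.prob (pair_pmf (word_pmf k N) (word_pmf k N)) {(xs, ys). \<not> common_perm S xs ys} \<le>
     measure_pmf.prob (pair_pmf (word_pmf k m) (word_pmf k m)) ?A + j * \<epsilon>"
    unfolding N pair_word_pmf_add
  proof (rule measure_pmf_bind_le_add)
    fix p assume p: "p \<notin> ?A"
    obtain xs ys where p_eq: "p = (xs, ys)" by force
    with p obtain s where s: "s \<in> S" "s \<in> set xs" "s \<in> set ys" by auto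
    let ?P = "pair_pmf (word_pmf k n) (word_pmf k n)"
    \<comment> \<open>Any common symbol \<open>s\<close> may be used up here: the bound for the
      remaining letters depends only on the size of \<open>S - {s}\<close>.\<close>
    have "measure_pmf.prob ?P {(xs', ys'). \<not> common_perm S (xs @ xs') (ys @ ys')} \<le>
      measure_pmf.prob ?P {(xs', ys'). \<not> common_perm (S - {s}) xs' ys'}"
      using common_perm_append[OF s] by (intro measure_pmf.finite_measure_mono) auto
    also have "\<dots> \<le> card (S - {s}) * \<epsilon>"
      using Suc.prems s fin n by (intro Suc.hyps(1)) (auto simp flip: Suc.hyps(2))
    also have "card (S - {s}) = j" using s fin by (simp flip: Suc.hyps(2))
    finally show "measure_pmf.prob (case p of (xs, ys) \<Rightarrow>
       map_pmf (\<lambda>(xs', ys'). (xs @ xs', ys @ ys')) ?P) {(xs, ys). \<not> common_perm S xs ys} \<le> j * \<epsilon>"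
      by (simp add: p_eq vimage_def case_prod_beta')
  qed (use \<epsilon> in auto)
  also have "measure_pmf.prob (pair_pmf (word_pmf k m) (word_pmf k m)) ?A \<le> \<epsilon>"
    using prob_word_pair_disjoint[of k S m] t[of "card S"] k Suc.prems cS Suc.hyps(2)
    by (simp add: m_def)
  finally show ?case by (simp add: algebra_simps flip: Suc.hyps(2))
qed

section \<open>Block lengths, their failure probability and their sum\<close>

text \<open>By \<open>1 + u \<le> exp u\<close> it reduces to \<open>u * u \<le> u\<close>. It turns
  a bound on missing a symbol into a linear lower bound on meeting it.\<close>

lemma exp_minus_le_half:
  fixes u :: real
  assumes "0 \<le> u" "u \<le> 1"
  shows "exp (- u) \<le> 1 - u / 2"
proof -
  have "exp (- u) = 1 / exp u" by (simp add: exp_minus field_simps)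
  also have "\<dots> \<le> 1 / (1 + u)" using assms by (intro divide_left_mono) auto
  also have "\<dots> \<le> 1 - u / 2"
  proof -
    have "u * u \<le> u" using assms mult_left_le[of u u] by simp
    then show ?thesis using assms by (simp add: field_simps)
  qed
  finally show ?thesis .
qed

lemma one_minus_inverse_power_le_exp:
  assumes "k > (0::nat)" "real k * x \<le> real t"
  shows "(1 - 1 / k) ^ t \<le> exp (- x)"
proof -
  have "(1 - 1 / real k) ^ t \<le> exp (- 1 / k) ^ t"
    using assms exp_ge_add_one_self[of "- 1 / real k"] by (intro power_mono) (auto simp: field_simps)
  also have "\<dots> = exp (- (t / k))" by (simp flip: exp_of_nat_mult)
  also have "\<dots> \<le> exp (- x)" using assms by (simp add: field_simps)
  finally show ?thesis .
qed

text \<open>Each step aims at failure probability \<open>exp (- L)\<close>. The 2 before the root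
  offsets the 1/2 in \<open>exp (- u) \<le> 1 - u / 2\<close>; the 2 in \<open>2 * k * L\<close>
  pays for either block missing the symbol.\<close>

definition block_length :: "nat \<Rightarrow> real \<Rightarrow> nat \<Rightarrow> nat" where
  "block_length k L j = nat \<lceil>if 4 * L \<le> j then 2 * k * sqrt (L / j) else 2 * k * L\<rceil>"

text \<open>A given symbol misses a block with probability \<open>r\<close>. For large
  \<open>j\<close>, \<open>1 - r\<close> is at least \<open>sqrt (L / j)\<close>, and
  \<open>(1 - L / j) ^ j \<le> exp (- L)\<close>. For small \<open>j\<close>,
  \<open>r \<le> exp (- (2 * L))\<close>, and \<open>ln 2 \<le> L\<close> absorbs the factor in
  \<open>2 * r\<close>.\<close>

lemma block_length_failure:
  assumes k: "k > 1" and j: "1 \<le> j" and L: "ln 2 \<le> L"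
  shows "(1 - (1 - (1 - 1 / k) ^ block_length k L j)\<^sup>2) ^ j \<le> exp (- L)"
proof -
  have L0: "L > 0" using L ln_gt_zero[of "2::real"] by linarith
  define r where "r = (1 - 1 / real k) ^ block_length k L j"
  have r: "0 \<le> r" "r \<le> 1"
    using k unfolding r_def by (auto intro!: power_le_one zero_le_power)
  have sq: "(1 - r)\<^sup>2 \<le> 1" using r by (intro power_le_one) auto
  show ?thesis
  proof (cases "4 * L \<le> j")
    case True
    \<comment> \<open>\<open>k * u\<close> is the block length before rounding; the threshold
      \<open>4 * L \<le> j\<close> says exactly that \<open>u \<le> 1\<close>.\<close>
    define u where "u = 2 * sqrt (L / j)"
    have u0: "0 \<le> u" using L0 by (simp add: u_def)
    have usq: "(u / 2)\<^sup>2 = L / j" using L0 j by (simp add: u_def)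
    have "u\<^sup>2 = 4 * L / j" using usq by (simp add: power_divide)
    also have "\<dots> \<le> 1" using True j by simp
    finally have "u\<^sup>2 \<le> 1" .
    then have u1: "u \<le> 1" by (simp add: abs_square_le_1)
    have "r \<le> exp (- u)"
      unfolding r_def using k True by (intro one_minus_inverse_power_le_exp)
        (auto simp: block_length_def u_def mult_ac real_nat_ceiling_ge)
    also have "\<dots> \<le> 1 - u / 2" using u0 u1 by (rule exp_minus_le_half)
    finally have "u / 2 \<le> 1 - r" by simp
    then have "(u / 2)\<^sup>2 \<le> (1 - r)\<^sup>2" using u0 by (intro power_mono) auto
    then have "(1 - (1 - r)\<^sup>2) ^ j \<le> (1 - L / j) ^ j"
      using sq by (intro power_mono) (auto simp: usq)
    also have "\<dots> \<le> exp (- L / j) ^ j"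
      using exp_ge_add_one_self[of "- L / j"] True L0 j by (intro power_mono) (auto simp: field_simps)
    also have "\<dots> = exp (- L)" using j by (simp flip: exp_of_nat_mult)
    finally show ?thesis by (simp add: r_def)
  next
    case False
    have "r \<le> exp (- (2 * L))"
      unfolding r_def using k False
      by (intro one_minus_inverse_power_le_exp) (auto simp: block_length_def mult_ac real_nat_ceiling_ge)
    also have "\<dots> = exp (- L) * exp (- L)" by (simp flip: exp_add)
    also have "\<dots> \<le> exp (- L) * exp (- ln 2)" using L by (intro mult_left_mono) auto
    finally have "2 * r \<le> exp (- L)" by (simp add: exp_minus)
    \<comment> \<open>The base lies between 0 and 1, so the exponent may drop to 1: a single missing
      symbol is enough.\<close>
    have "(1 - (1 - r)\<^sup>2) ^ j \<le> (1 - (1 - r)\<^sup>2) ^ 1"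
      using sq j by (intro power_decreasing) auto
    also have "\<dots> \<le> 2 * r" by (simp add: power2_eq_square algebra_simps)
    also note \<open>2 * r \<le> exp (- L)\<close>
    finally show ?thesis by (simp add: r_def)
  qed
qed

text \<open>Telescoping: each term is at most twice the increment of the square root.\<close>

lemma sum_inverse_sqrt_le: "(\<Sum>j=1..k. 1 / sqrt (real j)) \<le> 2 * sqrt k"
proof (induction k)
  case (Suc k)
  have "(sqrt (Suc k) - sqrt k) * (sqrt (Suc k) + sqrt k) = 1"
    by (simp add: algebra_simps flip: power2_eq_square)
  moreover have "sqrt (Suc k) - sqrt k \<ge> 0" by simp
  ultimately have "1 \<le> (sqrt (Suc k) - sqrt k) * (2 * sqrt (Suc k))"
    by (smt (verit) mult_left_mono)
  then have "1 / sqrt (Suc k) \<le> 2 * sqrt (Suc k) - 2 * sqrt k"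
    by (simp add: divide_simps algebra_simps)
  then show ?case using Suc by simp
qed simp

text \<open>Three contributions: the root regime, rounding up by at most 1 per block, and at most
  \<open>4 * L\<close> long blocks of \<open>2 * k * L\<close> letters.\<close>

lemma sum_block_length_le:
  assumes L: "L \<ge> 0"
  shows "real (\<Sum>j=1..k. block_length k L j) \<le> 4 * k * sqrt L * sqrt k + k + 8 * k * L\<^sup>2"
proof -
  let ?J = "{j\<in>{1..k}. real j < 4 * L}"
  have "?J \<subseteq> {1..nat \<lfloor>4 * L\<rfloor>}" by (auto simp: le_nat_iff le_floor_iff)
  then have "card ?J \<le> nat \<lfloor>4 * L\<rfloor>" using card_mono[of "{1..nat \<lfloor>4 * L\<rfloor>}" ?J] by simp
  then have J: "real (card ?J) \<le> 4 * L" using L by linarith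
  \<comment> \<open>The root term is charged to every \<open>j\<close>, even for long blocks, so
    that only the last term needs a case distinction.\<close>
  have "real (\<Sum>j=1..k. block_length k L j) \<le>
      (\<Sum>j=1..k. 2 * k * sqrt L * (1 / sqrt j) + 1 + (if real j < 4 * L then 2 * k * L else 0))"
    unfolding of_nat_sum
  proof (rule sum_mono)
    fix j :: nat
    have *: "real (nat \<lceil>x\<rceil>) \<le> x + 1" if "0 \<le> x" for x :: real using that by linarith
    show "real (block_length k L j) \<le>
      2 * k * sqrt L * (1 / sqrt j) + 1 + (if real j < 4 * L then 2 * k * L else 0)"
    proof (cases "4 * L \<le> j")
      case True
      then show ?thesis
        using *[of "2 * k * sqrt (L / j)"] L by (simp add: block_length_def real_sqrt_divide)
    next
      case False
      have nonneg: "0 \<le> 2 * k * sqrt L * (1 / sqrt j)" using L by simp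
      have "real (block_length k L j) \<le> 2 * k * L + 1"
        using False *[of "2 * k * L"] L by (simp add: block_length_def)
      moreover have "real j < 4 * L" using False by simp
      ultimately show ?thesis using nonneg by (simp only: if_True)
    qed
  qed
  also have "\<dots> = 2 * k * sqrt L * (\<Sum>j=1..k. 1 / sqrt j) + k + real (card ?J) * (2 * k * L)"
    by (simp add: sum.distrib sum_distrib_left sum.If_cases Int_def)
  also have "\<dots> \<le> 2 * k * sqrt L * (2 * sqrt k) + k + 4 * L * (2 * k * L)"
    using L J sum_inverse_sqrt_le[of k] by (intro add_mono mult_left_mono mult_right_mono) auto
  finally show ?thesis by (simp add: power2_eq_square mult_ac)
qed



section \<open>From common subsequences to matchings\<close>

text \<open>Edges map injectively to their symbols in \<open>{1..k}\<close>. This gives the upper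
  bound on \<open>R\<close> for every labelling, leaving only existence to chance.\<close>

lemma card_repetition_free_matching_le:
  assumes w: "\<And>v. v \<in> vertices_K n \<Longrightarrow> w v \<in> {1..k}"
    and M: "M \<subseteq> dom (kept_graph n w)" "repetition_free (kept_graph n w) M"
  shows "card M \<le> k"
proof -
  have "inj_on (\<lambda>e. the (kept_graph n w e)) M"
    using M(2) by (auto simp: repetition_free_def inj_on_def)
  moreover have "(\<lambda>e. the (kept_graph n w e)) ` M \<subseteq> {1..k}"
  proof
    fix s assume "s \<in> (\<lambda>e. the (kept_graph n w e)) ` M"
    then obtain i j where ij: "(i, j) \<in> M" "s = the (kept_graph n w (i, j))" by auto
    then have "(i, j) \<in> dom (kept_graph n w)" using M(1) by blast
    then have "s = w (VA i)" "VA i \<in> vertices_K n"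
      using ij(2) by (auto simp: kept_graph_def dom_def edges_K_def vertices_K_def split: if_splits)
    then show "s \<in> {1..k}" using w by auto
  qed
  ultimately show ?thesis
    using card_inj_on_le[of _ M "{1..k}"] by fastforce
qed

lemma subseq_mapE:
  assumes "subseq zs (map f xs)"
  obtains ys where "zs = map f ys" "subseq ys xs"
proof -
  from assms obtain N where "zs = map f (nths xs N)"
    by (auto simp: subseq_conv_nths nths_map)
  then show ?thesis using that by (auto simp: subseq_conv_nths)
qed

lemma subseq_set_subset: "subseq ys xs \<Longrightarrow> set ys \<subseteq> set xs"
  by (auto simp: subseq_conv_nths dest: in_set_nthsD)

lemma sorted_wrt_less_subseq_upt: "subseq ys [m..<n] \<Longrightarrow> sorted_wrt (<) ys"
  by (auto simp: subseq_conv_nths strict_sorted_iff intro: sorted_nths distinct_nthsI)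

text \<open>Edge \<open>i\<close> joins the positions of entry \<open>i\<close> of the common
  subsequence in the two words. Positions increase on both sides, so the edges do not cross;
  distinct entries give distinct symbols.\<close>

lemma R_eq_if_common_perm:
  assumes w: "\<And>v. v \<in> vertices_K n \<Longrightarrow> w v \<in> {1..k}"
    and cp: "common_perm {1..k} (map (\<lambda>i. w (VA i)) [1..<Suc n]) (map (\<lambda>j. w (VB j)) [1..<Suc n])"
  shows "R (kept_graph n w) = k"
proof -
  let ?G = "kept_graph n w"
  let ?V = "{M. M \<subseteq> dom ?G \<and> is_matching M \<and> noncrossing M \<and> repetition_free ?G M}"
  obtain zs where zs: "subseq zs (map (\<lambda>i. w (VA i)) [1..<Suc n])" "subseq zs (map (\<lambda>j. w (VB j)) [1..<Suc n])"
     "distinct zs" "set zs = {1..k}"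
    using cp by (auto simp: common_perm_def)
  obtain as where as: "zs = map (\<lambda>i. w (VA i)) as" "subseq as [1..<Suc n]"
    using zs(1) by (rule subseq_mapE)
  obtain bs where bs: "zs = map (\<lambda>j. w (VB j)) bs" "subseq bs [1..<Suc n]"
    using zs(2) by (rule subseq_mapE)
  have len: "length zs = k" "length as = k" "length bs = k"
    using distinct_card[OF zs(3)] zs(4) as(1) bs(1) by (auto dest: arg_cong[where f = length])
  have less: "as ! i < as ! j" "bs ! i < bs ! j" if "i < j" "j < k" for i j
    using that len sorted_wrt_nth_less[OF sorted_wrt_less_subseq_upt[OF as(2)], of i j]
      sorted_wrt_nth_less[OF sorted_wrt_less_subseq_upt[OF bs(2)], of i j] by simp_all
  have G: "?G (as ! i, bs ! i) = Some (zs ! i)" if "i < k" for i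
  proof -
    have "as ! i \<in> set [1..<Suc n]" "bs ! i \<in> set [1..<Suc n]"
      using subseq_set_subset[OF as(2)] subseq_set_subset[OF bs(2)] that len
      by (metis nth_mem subsetD)+
    moreover have "w (VA (as ! i)) = zs ! i" "w (VB (bs ! i)) = zs ! i"
      using that len by (simp add: as(1)) (use that len in \<open>simp add: bs(1)\<close>)
    ultimately show ?thesis by (auto simp: kept_graph_def edges_K_def)
  qed
  define M where "M = (\<lambda>i. (as ! i, bs ! i)) ` {..<k}"
  have nc: "noncrossing_edges (as ! i, bs ! i) (as ! j, bs ! j)" if "i \<noteq> j" "i < k" "j < k" for i j
    using that less[of i j] less[of j i] by (cases i j rule: linorder_cases) (simp_all add: noncrossing_edges_def)
  have noncrossing: "noncrossing M"
    by (auto simp: noncrossing_def M_def intro!: nc)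
  then have "is_matching M"
    by (fastforce simp: is_matching_def noncrossing_def noncrossing_edges_def)
  moreover note noncrossing
  moreover have "repetition_free ?G M"
    using zs(3) len by (auto simp: repetition_free_def M_def G nth_eq_iff_index_eq)
  moreover have "M \<subseteq> dom ?G" by (auto simp: M_def G)
  moreover have "card M = k"
  proof -
    have "inj_on (\<lambda>i. (as ! i, bs ! i)) {..<k}"
      using nc by (intro inj_onI) (fastforce simp: noncrossing_edges_def)
    then show ?thesis by (simp add: M_def card_image)
  qed
  ultimately have "k \<in> card ` ?V" by (intro image_eqI[of _ _ M]) auto
  \<comment> \<open>Provides both the finiteness that \<open>Max\<close> requires and the upper
    bound.\<close>
  moreover have "card ` ?V \<subseteq> {..k}"
    using card_repetition_free_matching_le[OF w] by auto
  ultimately show ?thesis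
    unfolding R_def by (intro Max_eqI) (auto intro: finite_subset)
qed

section \<open>Asymptotics and the passage from vertices to words\<close>

text \<open>The leading term on the left is smaller than that on the right by a factor of order
  \<open>sqrt (ln k)\<close>. The \<open>- 1\<close> makes room for the rounding of
  \<open>n\<close>.\<close>

lemma eventually_blocks_fit:
  fixes \<xi> :: real
  assumes "\<xi> > 0"
  shows "eventually (\<lambda>k::nat. 4 * k * sqrt ((1 + \<xi>) * ln k) * sqrt k + k + 8 * k * ((1 + \<xi>) * ln k)\<^sup>2
     \<le> (1 / 2 + \<xi>) * k * sqrt k * ln k - 1) at_top"
proof -
  have "eventually (\<lambda>x::real. 4 * x * sqrt ((1 + \<xi>) * ln x) * sqrt x + x + 8 * x * ((1 + \<xi>) * ln x)\<^sup>2
     \<le> (1 / 2 + \<xi>) * x * sqrt x * ln x - 1) at_top"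
    using assms by real_asymp
  then show ?thesis
    by (rule eventually_compose_filterlim[OF _ filterlim_real_sequentially])
qed

lemma map_pmf_split_word:
  assumes "k > 0"
  shows "map_pmf (\<lambda>zs. (take m zs, drop m zs)) (word_pmf k (m + n)) = pair_pmf (word_pmf k m) (word_pmf k n)"
proof -
  have "map_pmf (\<lambda>zs. (take m zs, drop m zs)) (word_pmf k (m + n)) =
    word_pmf k m \<bind> (\<lambda>xs. map_pmf (\<lambda>ys. (take m (xs @ ys), drop m (xs @ ys))) (word_pmf k n))"
    by (simp add: word_pmf_add map_bind_pmf pmf.map_comp o_def)
  also have "\<dots> = word_pmf k m \<bind> (\<lambda>xs. map_pmf (\<lambda>ys. (xs, ys)) (word_pmf k n))"
    using assms by (intro bind_pmf_cong refl map_pmf_cong) (auto simp: set_word_pmf)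
  finally show ?thesis by (simp add: pair_pmf_def map_pmf_def)
qed

text \<open>All labels, read with the \<open>VA\<close> side first, form one random word of length
  \<open>n + n\<close>; cutting it in the middle gives two independent words.\<close>

lemma random_words_of_vertices:
  assumes "k > 0"
  shows "map_pmf (\<lambda>w. (map (\<lambda>i. w (VA i)) [1..<Suc n], map (\<lambda>j. w (VB j)) [1..<Suc n]))
      (Pi_pmf (vertices_K n) 0 (\<lambda>_. pmf_of_set {1..k})) = pair_pmf (word_pmf k n) (word_pmf k n)"
proof -
  define vs where "vs = map VA [1..<Suc n] @ map VB [1..<Suc n]"
  have "set vs = vertices_K n" "distinct vs" "length vs = n + n"
    by (auto simp: vs_def vertices_K_def distinct_map inj_on_def simp del: upt_Suc)
  then have "map_pmf (\<lambda>w. map w vs) (Pi_pmf (vertices_K n) 0 (\<lambda>_. pmf_of_set {1..k})) = word_pmf k (n + n)"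
    using map_pmf_Pi_pmf_list[of vs 0 "pmf_of_set {1..k}"] by (simp add: word_pmf_def)
  then have "map_pmf (\<lambda>zs. (take n zs, drop n zs)) (map_pmf (\<lambda>w. map w vs)
      (Pi_pmf (vertices_K n) 0 (\<lambda>_. pmf_of_set {1..k}))) = pair_pmf (word_pmf k n) (word_pmf k n)"
    using map_pmf_split_word[OF assms, of n n] by simp
  then show ?thesis by (simp add: vs_def pmf.map_comp o_def del: upt_Suc)
qed

theorem theorem13:
  fixes \<xi> :: real
  assumes "\<xi> > 0"
  shows "\<exists>k\<^sub>0 :: nat. \<forall>k > k\<^sub>0. \<forall>n :: nat.
           \<bar>real n - (1 / 2 + \<xi>) * real k * sqrt (real k) * ln (real k)\<bar> < 1 \<longrightarrow>
           measure_pmf.prob (random_word_graph n k) {G. R G \<noteq> k} \<le> 2 / real k powr \<xi>"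
proof -
  obtain K :: nat where K: "\<forall>k\<ge>K. 4 * k * sqrt ((1 + \<xi>) * ln k) * sqrt k + k + 8 * k * ((1 + \<xi>) * ln k)\<^sup>2
     \<le> (1 / 2 + \<xi>) * k * sqrt k * ln k - 1"
    using eventually_blocks_fit[OF assms, unfolded eventually_at_top_linorder] ..
  show ?thesis
  \<comment> \<open>The 1 ensures \<open>k > 1\<close>, hence
    \<open>ln 2 \<le> ln k\<close>.\<close>
  proof (intro exI[of _ "max K 1"] allI impI)
    fix k n :: nat
    assume k: "k > max K 1"
      and n: "\<bar>real n - (1 / 2 + \<xi>) * real k * sqrt (real k) * ln (real k)\<bar> < 1"
    \<comment> \<open>Makes \<open>exp (- L)\<close> equal to \<open>k powr (-1 - \<xi>)\<close>, so
      that \<open>k\<close> greedy steps fail with total probability at most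
      \<open>1 / k powr \<xi>\<close>.\<close>
    define L where "L = (1 + \<xi>) * ln k"
    have k1: "k > 1" "k \<ge> K" using k by auto
    have "ln 2 \<le> ln (real k)" using k1 by simp
    moreover have "1 * ln (real k) \<le> L"
      unfolding L_def using assms k1 by (intro mult_right_mono) auto
    ultimately have L2: "ln 2 \<le> L" by simp
    then have L0: "0 \<le> L" using ln_gt_zero[of "2::real"] by linarith
    have "real (\<Sum>j=1..k. block_length k L j) \<le> real n"
      using sum_block_length_le[OF L0, of k] K[rule_format, OF k1(2)] n unfolding L_def by linarith
    then have fit: "(\<Sum>j=1..card {1..k}. block_length k L j) \<le> n"
      by (simp del: of_nat_sum)
    let ?W = "Pi_pmf (vertices_K n) 0 (\<lambda>_. pmf_of_set {1..k})"
    let ?words = "\<lambda>w. (map (\<lambda>i. w (VA i)) [1..<Suc n], map (\<lambda>j. w (VB j)) [1..<Suc n])"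
    let ?bad = "{(xs, ys). \<not> common_perm {1..k} xs ys}"
    have "measure_pmf.prob (random_word_graph n k) {G. R G \<noteq> k} = measure_pmf.prob ?W {w. R (kept_graph n w) \<noteq> k}"
      by (simp add: random_word_graph_def vimage_def)
    also have "\<dots> \<le> measure_pmf.prob ?W (?words -` ?bad)"
    \<comment> \<open>The inclusion is checked on the support of \<open>?W\<close>, where all labels
      lie in \<open>{1..k}\<close> and \<open>R\<close> is therefore at most
      \<open>k\<close>.\<close>
    proof (rule measure_pmf.finite_measure_mono_AE)
      have "R (kept_graph n w) = k" if "w \<in> set_pmf ?W" "?words w \<notin> ?bad" for w
      proof (rule R_eq_if_common_perm)
        have "finite (vertices_K n)" by (simp add: vertices_K_def)
        then show "w v \<in> {1..k}" if "v \<in> vertices_K n" for v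
          using \<open>w \<in> set_pmf ?W\<close> that k1 by (simp add: set_Pi_pmf PiE_dflt_def)
      qed (use that in auto)
      then show "AE w in measure_pmf ?W. w \<in> {w. R (kept_graph n w) \<noteq> k} \<longrightarrow> w \<in> ?words -` ?bad"
        unfolding AE_measure_pmf_iff by blast
    qed simp
    also have "\<dots> = measure_pmf.prob (map_pmf ?words ?W) ?bad" by simp
    also have "map_pmf ?words ?W = pair_pmf (word_pmf k n) (word_pmf k n)"
      using k1 by (intro random_words_of_vertices) auto
    also have "measure_pmf.prob \<dots> ?bad \<le> card {1..k} * exp (- L)"
      using k1 L2 fit by (intro prob_no_common_perm[where t = "block_length k L"] block_length_failure) auto
    also have "exp (- L) = 1 / (k * real k powr \<xi>)"
      using k1 by (simp add: L_def powr_def exp_minus exp_add distrib_right divide_inverse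
          del: mult_minus_left minus_add_distrib)
    also have "card {1..k} * \<dots> = 1 / real k powr \<xi>" using k1 by simp
    also have "\<dots> \<le> 2 / real k powr \<xi>" by (intro divide_right_mono) auto
    finally show "measure_pmf.prob (random_word_graph n k) {G. R G \<noteq> k} \<le> 2 / real k powr \<xi>" .
  qed
qed

end
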